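(* Let $T$ be a nonnegative Hamiltonian operator matrix on $H\times H$ with no eigenvalues on the imaginary axis, i.e. $\sigma_p(T)\cap i\mathbb R=\varnothing$, and consider the subspaces $$U_\pm=\overline{\sum_{\lambda\in\sigma_p^\pm(T)}\mathcal L(\lambda)}.$$ Then $U_+$ is $J_2$-nonnegative and $U_-$ is $J_2$-nonpositive. If in addition $T$ is uniformly positive, has a Riesz basis of Jordan chains, each eigenvalue has finite multiplicity ($\dim\mathcal L(\lambda)<\infty$), and $\sigma_p(T)$ is contained in a strip around the imaginary axis, then $U_+$ is uniformly $J_2$-positive and $U_-$ is uniformly $J_2$-negative.
   Context: $H$ is a complex Hilbert space with scalar product $(\cdot|\cdot)$ (separable whenever Riesz bases are considered). Hamiltonian operator matrix: a block operator matrix $T=\begin{pmatrix}A&B\\C&-A^*\end{pmatrix}$ on $H\times H$ with domain $\mathcal D(T)=(\mathcal D(A)\cap\mathcal D(C))\times(\mathcal D(A^* )\cap\mathcal D(B))$, where $A,B,C$ are densely defined linear operators on $H$, $B$ and $C$ are symmetric, and $T$ is densely defined. $T$ is nonnegative if $B$ and $C$ are nonnegative, and uniformly positive if $B,C\ge\gamma$ for some $\gamma>0$ (i.e. $(Bv|v)\ge\gamma\|v\|^2$ on $\mathcal D(B)$, similarly for $C$). $J_2=\begin{pmatrix}0&I\\ I&0\end{pmatrix}$ and $[x|y]=(J_2x|y)$ on $H\times H$. A subspace $U$ is $J_2$-nonnegative (nonpositive) if $[x|x]\ge0$ ($\le0$) for all $x\in U$, and uniformly $J_2$-positive (negative) if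 there is $\alpha>0$ with $[x|x]\ge\alpha\|x\|^2$ ($-[x|x]\ge\alpha\|x\|^2$) for all $x\in U$. $\sigma_p^+(T)$ and $\sigma_p^-(T)$ are the sets of eigenvalues in the open right and open left half-plane; $\mathcal L(\lambda)=\bigcup_k\ker(T-\lambda)^k$. A Jordan chain is a sequence $x_1,\dots,x_n$ in $\mathcal L(\lambda)$ with $(T-\lambda)x_1=0$ and $(T-\lambda)x_k=x_{k-1}$ for $k\ge2$. A Riesz basis of a separable Hilbert space $V$ is a sequence $(v_k)$ for which there is an isomorphism $\Phi:V\to V$ with $(\Phi v_k)$ an orthonormal basis; a Riesz basis of Jordan chains for $T$ is a Riesz basis (here of $H\times H$) made up of Jordan chains of $T$. A strip around the imaginary axis is a set $\{z:|\operatorname{Re}z|\le a\}$, $a\geq 0$. *)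

theory Defs
  imports "HOL-Analysis.Analysis" "HOL-Library.Complex_Order"
begin

section \<open>Complex Hilbert spaces\<close>

text \<open>
  The scalar product is linear in its first and conjugate-linear in its second argument.
  The order on \<^typ>\<open>complex\<close> is that of \<^theory>\<open>HOL-Library.Complex_Order\<close>: an
  inequality \<^prop>\<open>(0::complex) \<le> z\<close> includes the statement that \<open>z\<close> is real.
\<close>

class complex_inner = real_normed_vector +
  fixes scaleC :: "complex \<Rightarrow> 'a \<Rightarrow> 'a" (infixr "*\<^sub>C" 75)
    and cinner :: "'a \<Rightarrow> 'a \<Rightarrow> complex"
  assumes scaleC_add_right: "c *\<^sub>C (x + y) = c *\<^sub>C x + c *\<^sub>C y"
    and scaleC_add_left: "(c + d) *\<^sub>C x = c *\<^sub>C x + d *\<^sub>C x"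
    and scaleC_scaleC: "c *\<^sub>C d *\<^sub>C x = (c * d) *\<^sub>C x"
    and scaleR_scaleC: "r *\<^sub>R x = complex_of_real r *\<^sub>C x"
    and cinner_commute: "cinner x y = cnj (cinner y x)"
    and cinner_add_left: "cinner (x + y) z = cinner x z + cinner y z"
    and cinner_scaleC_left: "cinner (c *\<^sub>C x) y = c * cinner x y"
    and norm_eq_sqrt_cinner: "norm x = sqrt (Re (cinner x x))"

class complex_hilbert = complex_inner + complete_space

instantiation prod :: (complex_inner, complex_inner) complex_inner
begin

definition scaleC_prod :: "complex \<Rightarrow> 'a \<times> 'b \<Rightarrow> 'a \<times> 'b"
  where "scaleC_prod c x = (c *\<^sub>C fst x, c *\<^sub>C snd x)"

definition cinner_prod :: "'a \<times> 'b \<Rightarrow> 'a \<times> 'b \<Rightarrow> complex"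
  where "cinner_prod x y = cinner (fst x) (fst y) + cinner (snd x) (snd y)"

instance
proof
  fix c d :: complex and r :: real and x y z :: "'a \<times> 'b"
  have nonneg: "Re (cinner a a) \<ge> 0" for a :: "'c::complex_inner"
    using norm_ge_zero [of a] unfolding norm_eq_sqrt_cinner by simp
  show "c *\<^sub>C (x + y) = c *\<^sub>C x + c *\<^sub>C y"
    by (simp add: scaleC_prod_def scaleC_add_right)
  show "(c + d) *\<^sub>C x = c *\<^sub>C x + d *\<^sub>C x"
    by (simp add: scaleC_prod_def scaleC_add_left)
  show "c *\<^sub>C d *\<^sub>C x = (c * d) *\<^sub>C x"
    by (simp add: scaleC_prod_def scaleC_scaleC)
  show "r *\<^sub>R x = complex_of_real r *\<^sub>C x"
    by (simp add: scaleC_prod_def scaleR_prod_def scaleR_scaleC)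
  show "cinner x y = cnj (cinner y x)"
    unfolding cinner_prod_def complex_cnj_add by (metis cinner_commute)
  show "cinner (x + y) z = cinner x z + cinner y z"
    by (simp add: cinner_prod_def cinner_add_left)
  show "cinner (c *\<^sub>C x) y = c * cinner x y"
    by (simp add: cinner_prod_def scaleC_prod_def cinner_scaleC_left algebra_simps)
  show "norm x = sqrt (Re (cinner x x))"
    unfolding norm_prod_def cinner_prod_def norm_eq_sqrt_cinner [of "fst x"]
      norm_eq_sqrt_cinner [of "snd x"]
    using nonneg [of "fst x"] nonneg [of "snd x"] by simp
qed

end

instance prod :: (complex_hilbert, complex_hilbert) complex_hilbert ..

instantiation complex :: complex_hilbert
begin

definition scaleC_complex :: "complex \<Rightarrow> complex \<Rightarrow> complex"
  where "scaleC_complex c x = c * x"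

definition cinner_complex :: "complex \<Rightarrow> complex \<Rightarrow> complex"
  where "cinner_complex x y = x * cnj y"

instance
  by standard
    (auto simp: scaleC_complex_def cinner_complex_def algebra_simps scaleR_conv_of_real
      complex_norm_square [symmetric] cmod_def power2_eq_square)

end

interpretation complex_vector: vector_space "scaleC :: complex \<Rightarrow> 'a \<Rightarrow> 'a::complex_inner"
proof
  fix x :: 'a
  show "1 *\<^sub>C x = x"
    using scaleR_scaleC [of 1 x] by simp
qed (simp_all add: scaleC_add_right scaleC_add_left scaleC_scaleC)

abbreviation csubspace :: "'a::complex_inner set \<Rightarrow> bool"
  where "csubspace \<equiv> module.subspace scaleC"

abbreviation cspan :: "'a::complex_inner set \<Rightarrow> 'a set"
  where "cspan \<equiv> module.span scaleC"

definition finite_dimensional :: "'a::complex_inner set \<Rightarrow> bool"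
  where "finite_dimensional U \<longleftrightarrow> (\<exists>F. finite F \<and> U \<subseteq> cspan F)"


section \<open>Unbounded operators\<close>

text \<open>
  An operator with domain \<open>D \<subseteq> 'a\<close> is a partial function \<open>'a \<rightharpoonup> 'a\<close>, so that its domain
  is \<^term>\<open>dom S\<close> and its value at a point \<open>x\<close> of the domain is \<^term>\<open>the (S x)\<close>.
\<close>

definition linear_op :: "('a::complex_inner \<rightharpoonup> 'a) \<Rightarrow> bool"
  where "linear_op S \<longleftrightarrow> csubspace (dom S) \<and>
    (\<forall>x\<in>dom S. \<forall>y\<in>dom S. S (x + y) = Some (the (S x) + the (S y))) \<and>
    (\<forall>c. \<forall>x\<in>dom S. S (c *\<^sub>C x) = Some (c *\<^sub>C the (S x)))"

definition densely_defined :: "('a::complex_inner \<rightharpoonup> 'a) \<Rightarrow> bool"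
  where "densely_defined S \<longleftrightarrow> closure (dom S) = UNIV"

definition symmetric_op :: "('a::complex_inner \<rightharpoonup> 'a) \<Rightarrow> bool"
  where "symmetric_op S \<longleftrightarrow>
    (\<forall>u\<in>dom S. \<forall>v\<in>dom S. cinner (the (S u)) v = cinner u (the (S v)))"

definition nonnegative_op :: "('a::complex_inner \<rightharpoonup> 'a) \<Rightarrow> bool"
  where "nonnegative_op S \<longleftrightarrow> (\<forall>v\<in>dom S. 0 \<le> cinner (the (S v)) v)"

definition bounded_below_op :: "real \<Rightarrow> ('a::complex_inner \<rightharpoonup> 'a) \<Rightarrow> bool"
  where "bounded_below_op \<gamma> S \<longleftrightarrow>
    (\<forall>v\<in>dom S. complex_of_real (\<gamma> * (norm v)\<^sup>2) \<le> cinner (the (S v)) v)"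

text \<open>
  The element \<open>w\<close> below is unique if \<open>S\<close> is densely defined; the adjoint is used for
  densely defined operators only.
\<close>

definition adjoint_op :: "('a::complex_inner \<rightharpoonup> 'a) \<Rightarrow> ('a \<rightharpoonup> 'a)"
  where "adjoint_op S = (\<lambda>v.
    if \<exists>w. \<forall>u\<in>dom S. cinner (the (S u)) v = cinner u w
    then Some (THE w. \<forall>u\<in>dom S. cinner (the (S u)) v = cinner u w)
    else None)"

definition uminus_op :: "('a::complex_inner \<rightharpoonup> 'a) \<Rightarrow> ('a \<rightharpoonup> 'a)"
  where "uminus_op S = (\<lambda>x. map_option uminus (S x))"

definition block_op ::
  "('a::complex_inner \<rightharpoonup> 'a) \<Rightarrow> ('a \<rightharpoonup> 'a) \<Rightarrow> ('a \<rightharpoonup> 'a) \<Rightarrow> ('a \<rightharpoonup> 'a) \<Rightarrow> ('a \<times> 'a \<rightharpoonup> 'a \<times> 'a)"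
  where "block_op A B C D = (\<lambda>(u, v).
    if u \<in> dom A \<inter> dom C \<and> v \<in> dom D \<inter> dom B
    then Some (the (A u) + the (B v), the (C u) + the (D v))
    else None)"

text \<open>\<open>shift_op T \<mu>\<close> is \<open>T - \<mu>\<close>, and \<open>pow_op S k\<close> is \<open>S\<^sup>k\<close> with its natural domain.\<close>

definition shift_op :: "('a::complex_inner \<rightharpoonup> 'a) \<Rightarrow> complex \<Rightarrow> ('a \<rightharpoonup> 'a)"
  where "shift_op T \<mu> = (\<lambda>x. map_option (\<lambda>y. y - \<mu> *\<^sub>C x) (T x))"

primrec pow_op :: "('a \<rightharpoonup> 'a) \<Rightarrow> nat \<Rightarrow> ('a \<rightharpoonup> 'a)"
  where
    "pow_op S 0 = Some"
  | "pow_op S (Suc k) = S \<circ>\<^sub>m pow_op S k"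

definition ker_op :: "('a::complex_inner \<rightharpoonup> 'a) \<Rightarrow> 'a set"
  where "ker_op S = {x. S x = Some 0}"

definition point_spectrum :: "('a::complex_inner \<rightharpoonup> 'a) \<Rightarrow> complex set"
  where "point_spectrum T = {\<mu>. \<exists>x. x \<noteq> 0 \<and> T x = Some (\<mu> *\<^sub>C x)}"

definition root_space :: "('a::complex_inner \<rightharpoonup> 'a) \<Rightarrow> complex \<Rightarrow> 'a set"
  where "root_space T \<mu> = (\<Union>k. ker_op (pow_op (shift_op T \<mu>) k))"

definition point_spectrum_plus :: "('a::complex_inner \<rightharpoonup> 'a) \<Rightarrow> complex set"
  where "point_spectrum_plus T = {\<mu> \<in> point_spectrum T. 0 < Re \<mu>}"

definition point_spectrum_minus :: "('a::complex_inner \<rightharpoonup> 'a) \<Rightarrow> complex set"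
  where "point_spectrum_minus T = {\<mu> \<in> point_spectrum T. Re \<mu> < 0}"

definition root_sum_closure :: "('a::complex_inner \<rightharpoonup> 'a) \<Rightarrow> complex set \<Rightarrow> 'a set"
  where "root_sum_closure T \<Lambda> = closure (cspan (\<Union>\<mu>\<in>\<Lambda>. root_space T \<mu>))"


section \<open>Riesz bases of Jordan chains\<close>

definition orthonormal_basis :: "'i set \<Rightarrow> ('i \<Rightarrow> 'a::complex_inner) \<Rightarrow> bool"
  where "orthonormal_basis I e \<longleftrightarrow>
    (\<forall>i\<in>I. \<forall>j\<in>I. cinner (e i) (e j) = (if i = j then 1 else 0)) \<and>
    closure (cspan (e ` I)) = UNIV"

definition isomorphism :: "('a::complex_inner \<Rightarrow> 'a) \<Rightarrow> bool"
  where "isomorphism \<Phi> \<longleftrightarrow> bij \<Phi> \<and> bounded_linear \<Phi> \<and> bounded_linear (inv \<Phi>) \<and>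
    (\<forall>c x. \<Phi> (c *\<^sub>C x) = c *\<^sub>C \<Phi> x)"

text \<open>
  A sequence is rendered as a family over a countable index set, which also covers
  finite-dimensional spaces. The enumeration of the index set plays no role, since being
  an orthonormal basis does not depend on the order.
\<close>

definition riesz_basis :: "'i set \<Rightarrow> ('i \<Rightarrow> 'a::complex_inner) \<Rightarrow> bool"
  where "riesz_basis I v \<longleftrightarrow> countable I \<and>
    (\<exists>\<Phi>. isomorphism \<Phi> \<and> orthonormal_basis I (\<lambda>i. \<Phi> (v i)))"

definition jordan_chain :: "('a::complex_inner \<rightharpoonup> 'a) \<Rightarrow> complex \<Rightarrow> 'a list \<Rightarrow> bool"
  where "jordan_chain T \<mu> xs \<longleftrightarrow> xs \<noteq> [] \<and> set xs \<subseteq> root_space T \<mu> \<and>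
    shift_op T \<mu> (xs ! 0) = Some 0 \<and>
    (\<forall>k. Suc k < length xs \<longrightarrow> shift_op T \<mu> (xs ! Suc k) = Some (xs ! k))"

text \<open>
  The basis consists of the vectors \<open>xs j ! k\<close> of countably many finite chains \<open>xs j\<close>,
  \<open>j \<in> J\<close>; the same eigenvalue \<open>\<mu> j\<close> may belong to several chains.
\<close>

definition has_riesz_basis_of_jordan_chains :: "('a::complex_inner \<rightharpoonup> 'a) \<Rightarrow> bool"
  where "has_riesz_basis_of_jordan_chains T \<longleftrightarrow>
    (\<exists>(J :: nat set) \<mu> xs. (\<forall>j\<in>J. jordan_chain T (\<mu> j) (xs j)) \<and>
      riesz_basis (SIGMA j:J. {..<length (xs j)}) (\<lambda>(j, k). xs j ! k))"


section \<open>Hamiltonian operator matrices and the indefinite inner product\<close>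

definition hamiltonian ::
  "('a::complex_inner \<rightharpoonup> 'a) \<Rightarrow> ('a \<rightharpoonup> 'a) \<Rightarrow> ('a \<rightharpoonup> 'a) \<Rightarrow> ('a \<times> 'a \<rightharpoonup> 'a \<times> 'a) \<Rightarrow> bool"
  where "hamiltonian A B C T \<longleftrightarrow>
    linear_op A \<and> linear_op B \<and> linear_op C \<and>
    densely_defined A \<and> densely_defined B \<and> densely_defined C \<and>
    symmetric_op B \<and> symmetric_op C \<and>
    T = block_op A B C (uminus_op (adjoint_op A)) \<and> densely_defined T"

definition nonnegative_hamiltonian ::
  "('a::complex_inner \<rightharpoonup> 'a) \<Rightarrow> ('a \<rightharpoonup> 'a) \<Rightarrow> ('a \<rightharpoonup> 'a) \<Rightarrow> ('a \<times> 'a \<rightharpoonup> 'a \<times> 'a) \<Rightarrow> bool"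
  where "nonnegative_hamiltonian A B C T \<longleftrightarrow>
    hamiltonian A B C T \<and> nonnegative_op B \<and> nonnegative_op C"

definition uniformly_positive_hamiltonian ::
  "('a::complex_inner \<rightharpoonup> 'a) \<Rightarrow> ('a \<rightharpoonup> 'a) \<Rightarrow> ('a \<rightharpoonup> 'a) \<Rightarrow> ('a \<times> 'a \<rightharpoonup> 'a \<times> 'a) \<Rightarrow> bool"
  where "uniformly_positive_hamiltonian A B C T \<longleftrightarrow>
    hamiltonian A B C T \<and> (\<exists>\<gamma>>0. bounded_below_op \<gamma> B \<and> bounded_below_op \<gamma> C)"

definition J2 :: "'a \<times> 'a \<Rightarrow> 'a \<times> 'a"
  where "J2 x = (snd x, fst x)"

definition J2_form :: "'a::complex_inner \<times> 'a \<Rightarrow> 'a \<times> 'a \<Rightarrow> complex"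
  where "J2_form x y = cinner (J2 x) y"

definition J2_nonnegative :: "('a::complex_inner \<times> 'a) set \<Rightarrow> bool"
  where "J2_nonnegative U \<longleftrightarrow> csubspace U \<and> (\<forall>x\<in>U. 0 \<le> J2_form x x)"

definition J2_nonpositive :: "('a::complex_inner \<times> 'a) set \<Rightarrow> bool"
  where "J2_nonpositive U \<longleftrightarrow> csubspace U \<and> (\<forall>x\<in>U. J2_form x x \<le> 0)"

definition uniformly_J2_positive :: "('a::complex_inner \<times> 'a) set \<Rightarrow> bool"
  where "uniformly_J2_positive U \<longleftrightarrow> csubspace U \<and>
    (\<exists>\<alpha>>0. \<forall>x\<in>U. complex_of_real (\<alpha> * (norm x)\<^sup>2) \<le> J2_form x x)"

definition uniformly_J2_negative :: "('a::complex_inner \<times> 'a) set \<Rightarrow> bool"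
  where "uniformly_J2_negative U \<longleftrightarrow> csubspace U \<and>
    (\<exists>\<alpha>>0. \<forall>x\<in>U. complex_of_real (\<alpha> * (norm x)\<^sup>2) \<le> - J2_form x x)"

end

theory Submission
  imports Defs
begin

text \<open>
  A vector \<open>x\<close> in the span of the root spaces for the right half-plane is the initial value of an
  orbit \<open>y' = - T y\<close> that decays exponentially. For a Hamiltonian, \<open>Re [Tx|x] = (Cu|u) + (Bv|v)\<close>
  with \<open>x = (u, v)\<close>, so \<open>[y|y]\<close> decreases to \<open>0\<close> and \<open>[x|x] \<ge> 0\<close>. For the left half-plane
  one reverses time.

  In the uniformly positive case \<open>Re [Tx|x] \<ge> \<gamma> \<parallel>x\<parallel>\<^sup>2\<close>. If \<open>\<Phi>\<close> maps the Riesz basis to an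
  orthonormal one and the eigenvalues satisfy \<open>\<bar>Re \<mu>\<bar> \<le> a\<close>, then
  \<open>\<bar>Re (\<Phi>Tx|\<Phi>x)\<bar> \<le> (a + 1) \<parallel>\<Phi>x\<parallel>\<^sup>2\<close>, so for small \<open>\<beta> > 0\<close> the same monotonicity argument
  applies to the form \<open>[x|x] - \<beta> \<parallel>\<Phi>x\<parallel>\<^sup>2\<close>.
\<close>

section \<open>Complex inner product spaces\<close>

lemma cinner_zero_left [simp]: "cinner 0 x = 0"
  using cinner_scaleC_left [of 0 0 x] by simp

lemma cinner_add_right: "cinner x (y + z) = cinner x y + cinner x z"
  by (metis cinner_commute cinner_add_left complex_cnj_add)

lemma cinner_scaleC_right: "cinner x (c *\<^sub>C y) = cnj c * cinner x y"
  by (metis cinner_commute cinner_scaleC_left complex_cnj_mult)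

lemma cinner_zero_right [simp]: "cinner x 0 = 0"
  by (metis cinner_commute cinner_zero_left complex_cnj_zero)

lemma cinner_minus_left: "cinner (- x) y = - cinner x y"
  by (metis add.inverse_inverse add_eq_0_iff cinner_add_left cinner_zero_left)

lemma cinner_minus_right: "cinner x (- y) = - cinner x y"
  by (metis cinner_commute cinner_minus_left complex_cnj_minus)

lemma cinner_diff_right: "cinner x (y - z) = cinner x y - cinner x z"
  using cinner_add_right [of x y "- z"] by (simp add: cinner_minus_right)

lemma cinner_sum_left: "cinner (\<Sum>i\<in>S. f i) y = (\<Sum>i\<in>S. cinner (f i) y)"
  by (induction S rule: infinite_finite_induct) (simp_all add: cinner_add_left)

lemma cinner_sum_right: "cinner x (\<Sum>i\<in>S. f i) = (\<Sum>i\<in>S. cinner x (f i))"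
  by (induction S rule: infinite_finite_induct) (simp_all add: cinner_add_right)

lemma cinner_self: "cinner x x = complex_of_real ((norm x)\<^sup>2)"
proof -
  have "Re (cinner x x) \<ge> 0"
    using norm_ge_zero [of x] unfolding norm_eq_sqrt_cinner by simp
  moreover have "Im (cinner x x) = 0"
    using arg_cong [OF cinner_commute [of x x], of Im] by simp
  ultimately show ?thesis
    by (simp add: norm_eq_sqrt_cinner complex_eq_iff)
qed

lemma norm_scaleC: "norm (c *\<^sub>C x) = cmod c * norm x"
proof -
  have "cinner (c *\<^sub>C x) (c *\<^sub>C x) = (c * cnj c) * cinner x x"
    by (simp add: cinner_scaleC_left cinner_scaleC_right)
  also have "\<dots> = complex_of_real ((cmod c * norm x)\<^sup>2)"
    by (simp add: cinner_self complex_norm_square [symmetric] power_mult_distrib)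
  finally show ?thesis
    by (simp add: norm_eq_sqrt_cinner [of "c *\<^sub>C x"])
qed

text \<open>Cauchy-Schwarz for real parts falls out of the triangle inequality: expand the square of
  \<open>norm (x + y)\<close> through the scalar product and compare with the square of
  \<open>norm x + norm y\<close>.\<close>

lemma Re_cinner_le: "Re (cinner x y) \<le> norm x * norm y"
proof -
  have "Re (cinner (x + y) (x + y)) = (norm x)\<^sup>2 + 2 * Re (cinner x y) + (norm y)\<^sup>2"
    unfolding cinner_add_left cinner_add_right
    using arg_cong [OF cinner_commute [of y x], of Re] by (simp add: cinner_self)
  moreover have "(norm (x + y))\<^sup>2 \<le> (norm x + norm y)\<^sup>2"
    by (intro power_mono norm_triangle_ineq) simp
  ultimately show ?thesis
    by (simp add: cinner_self power2_sum)
qed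

lemma abs_Re_cinner_le: "\<bar>Re (cinner x y)\<bar> \<le> norm x * norm y"
  using Re_cinner_le [of x y] Re_cinner_le [of "- x" y] by (simp add: cinner_minus_left abs_le_iff)

text \<open>Taking real parts turns the sesquilinear product into a real bilinear form, so the rules
  for limits and derivatives of \<open>bounded_bilinear\<close> maps apply.\<close>

lemma bounded_bilinear_Re_cinner: "bounded_bilinear (\<lambda>x y. Re (cinner x y))"
proof
  show "\<exists>K. \<forall>x y :: 'a. norm (Re (cinner x y)) \<le> norm x * norm y * K"
    by (intro exI [of _ 1]) (simp add: abs_Re_cinner_le)
qed (simp_all add: cinner_add_left cinner_add_right scaleR_scaleC cinner_scaleC_left
      cinner_scaleC_right)

text \<open>Regarded over the reals, this yields the product rule for orbits of the form
  \<open>E t *\<^sub>C w t\<close> with a complex exponential factor.\<close>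

lemma bounded_bilinear_scaleC: "bounded_bilinear (scaleC :: complex \<Rightarrow> 'a \<Rightarrow> 'a::complex_inner)"
proof
  show "\<exists>K. \<forall>c. \<forall>x :: 'a. norm (c *\<^sub>C x) \<le> norm c * norm x * K"
    by (intro exI [of _ 1]) (simp add: norm_scaleC)
qed (simp_all only: scaleC_add_left scaleC_add_right scaleR_scaleC [where 'a = 'a] scaleC_scaleC
      scaleR_conv_of_real mult.commute)

text \<open>Supplies the corrected form that gives the uniform bounds; with \<open>t = 0\<close> it
  also covers a single form multiplied by a sign.\<close>

lemma bounded_bilinear_real_combination:
  fixes b b' :: "'a::real_normed_vector \<Rightarrow> 'a \<Rightarrow> real"
  assumes "bounded_bilinear b" "bounded_bilinear b'"
  shows "bounded_bilinear (\<lambda>x y. r * b x y - t * b' x y)"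
proof -
  interpret b: bounded_bilinear b by fact
  interpret b': bounded_bilinear b' by fact
  obtain M where M: "\<And>x y. norm (b x y) \<le> norm x * norm y * M" using b.bounded by blast
  obtain M' where M': "\<And>x y. norm (b' x y) \<le> norm x * norm y * M'" using b'.bounded by blast
  show ?thesis
  proof
    show "\<exists>K. \<forall>x y. norm (r * b x y - t * b' x y) \<le> norm x * norm y * K"
    proof (intro exI allI)
      fix x y
      have "norm (r * b x y - t * b' x y) \<le> \<bar>r\<bar> * norm (b x y) + \<bar>t\<bar> * norm (b' x y)"
        by (rule order_trans [OF norm_triangle_ineq4]) (simp add: abs_mult)
      also have "\<dots> \<le> \<bar>r\<bar> * (norm x * norm y * M) + \<bar>t\<bar> * (norm x * norm y * M')"
        by (intro add_mono mult_left_mono M M') auto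
      finally show "norm (r * b x y - t * b' x y) \<le> norm x * norm y * (\<bar>r\<bar> * M + \<bar>t\<bar> * M')"
        by (simp add: algebra_simps)
    qed
  qed (simp_all add: b.add_left b.add_right b'.add_left b'.add_right b.scaleR_left b.scaleR_right
      b'.scaleR_left b'.scaleR_right algebra_simps)
qed

lemma csubspace_closure:
  fixes U :: "'a::complex_inner set"
  assumes "csubspace U"
  shows "csubspace (closure U)"
  unfolding complex_vector.subspace_def
proof (intro conjI ballI allI)
  note U = assms [unfolded complex_vector.subspace_def]
  show "0 \<in> closure U"
    using U closure_subset by blast
  show "x + y \<in> closure U" if x: "x \<in> closure U" and y: "y \<in> closure U" for x y
  proof -
    from x y obtain f g where "\<forall>n. f n \<in> U" "f \<longlonglongrightarrow> x" "\<forall>n. g n \<in> U" "g \<longlonglongrightarrow> y"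
      unfolding closure_sequential by blast
    with U have "\<forall>n. f n + g n \<in> U" "(\<lambda>n. f n + g n) \<longlonglongrightarrow> x + y"
      by (auto intro: tendsto_add)
    then show ?thesis unfolding closure_sequential by (intro exI conjI)
  qed
  show "c *\<^sub>C x \<in> closure U" if x: "x \<in> closure U" for c x
  proof -
    from x obtain f where "\<forall>n. f n \<in> U" "f \<longlonglongrightarrow> x"
      unfolding closure_sequential by blast
    with U have "\<forall>n. c *\<^sub>C f n \<in> U" "(\<lambda>n. c *\<^sub>C f n) \<longlonglongrightarrow> c *\<^sub>C x"
      by (auto intro: bounded_bilinear.tendsto [OF bounded_bilinear_scaleC])
    then show ?thesis unfolding closure_sequential by (intro exI conjI)
  qed
qed

lemma csubspace_root_sum_closure: "csubspace (root_sum_closure T \<Lambda>)"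
  unfolding root_sum_closure_def by (intro csubspace_closure complex_vector.subspace_span)

section \<open>Linear partial operators and the Hamiltonian\<close>

text \<open>Linearity in graph form: equations \<open>S x = Some x'\<close> carry domain membership
  and value together.\<close>

lemma linear_opD:
  assumes "linear_op S"
  shows "S 0 = Some 0"
    and "S x = Some x' \<Longrightarrow> S y = Some y' \<Longrightarrow> S (x + y) = Some (x' + y')"
    and "S x = Some x' \<Longrightarrow> S (c *\<^sub>C x) = Some (c *\<^sub>C x')"
proof -
  note S = assms [unfolded linear_op_def]
  show add: "S (x + y) = Some (x' + y')" if "S x = Some x'" "S y = Some y'" for x y x' y'
    using S that by (metis domI option.sel)
  show scale: "S (c *\<^sub>C x) = Some (c *\<^sub>C x')" if "S x = Some x'" for c x x'
    using S that by (metis domI option.sel)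
  from S obtain z where "S 0 = Some z"
    using complex_vector.subspace_0 by blast
  from scale [OF this, of 0] show "S 0 = Some 0" by simp
qed

lemma linear_opI:
  assumes "S 0 = Some 0"
    and "\<And>x y x' y'. S x = Some x' \<Longrightarrow> S y = Some y' \<Longrightarrow> S (x + y) = Some (x' + y')"
    and "\<And>c x x'. S x = Some x' \<Longrightarrow> S (c *\<^sub>C x) = Some (c *\<^sub>C x')"
  shows "linear_op S"
  unfolding linear_op_def complex_vector.subspace_def
  using assms by fastforce

lemma linear_op_sum:
  assumes "linear_op S" and "\<And>i. i \<in> K \<Longrightarrow> S (x i) = Some (y i)"
  shows "S (\<Sum>i\<in>K. c i *\<^sub>C x i) = Some (\<Sum>i\<in>K. c i *\<^sub>C y i)"
  using assms(2)
  by (induction K rule: infinite_finite_induct) (simp_all add: linear_opD [OF assms(1)])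

lemma linear_op_diff:
  assumes "linear_op S" "S x = Some x'" "S y = Some y'"
  shows "S (x - y) = Some (x' - y')"
  using linear_opD(2) [OF assms(1,2) linear_opD(3) [OF assms(1,3), of "-1"]]
  by simp

text \<open>Approximating \<open>w - w'\<close> itself from \<open>D\<close> gives
  \<open>(norm (w - w'))\<^sup>2 = 0\<close> in the limit. It makes the value of the adjoint
  unique.\<close>

lemma cinner_eq_on_dense_imp_eq:
  assumes "closure D = UNIV" and "\<And>u. u \<in> D \<Longrightarrow> cinner u w = cinner u w'"
  shows "w = w'"
proof -
  have "w - w' \<in> closure D" using assms(1) by simp
  then obtain f where f: "\<And>n. f n \<in> D" "f \<longlonglongrightarrow> w - w'"
    unfolding closure_sequential by blast
  have "(\<lambda>n. Re (cinner (f n) (w - w'))) \<longlonglongrightarrow> Re (cinner (w - w') (w - w'))"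
    by (intro bounded_bilinear.tendsto [OF bounded_bilinear_Re_cinner] f tendsto_const)
  then have "(\<lambda>n. 0) \<longlonglongrightarrow> (norm (w - w'))\<^sup>2"
    by (simp only: cinner_diff_right [of "f _"] assms(2) [OF f(1)] cinner_self) simp
  then show ?thesis
    using LIMSEQ_unique tendsto_const by fastforce
qed

text \<open>Density of the domain makes the definite description in \<open>adjoint_op\<close>
  meaningful; from here on the adjoint is handled through its defining identity alone.\<close>

lemma adjoint_op_eq_Some_iff:
  assumes "densely_defined S"
  shows "adjoint_op S v = Some w \<longleftrightarrow> (\<forall>u\<in>dom S. cinner (the (S u)) v = cinner u w)"
proof -
  let ?P = "\<lambda>w. \<forall>u\<in>dom S. cinner (the (S u)) v = cinner u w"
  have unique: "w' = w" if "?P w" "?P w'" for w w'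
    using assms that
    by (intro cinner_eq_on_dense_imp_eq [of "dom S"]) (simp_all add: densely_defined_def)
  have the: "(THE w. ?P w) = w" if "?P w" for w
    using that unique [OF that] by (rule the_equality)
  show ?thesis
  proof
    assume "?P w"
    then show "adjoint_op S v = Some w"
      unfolding adjoint_op_def the [OF \<open>?P w\<close>] by (intro if_P exI)
  next
    assume *: "adjoint_op S v = Some w"
    then obtain w' where "?P w'"
      unfolding adjoint_op_def by (auto split: if_splits)
    moreover from this have "adjoint_op S v = Some w'"
      unfolding adjoint_op_def the [OF \<open>?P w'\<close>] by (intro if_P exI)
    ultimately show "?P w" using * by simp
  qed
qed

lemma linear_op_adjoint:
  assumes "densely_defined S"
  shows "linear_op (adjoint_op S)"
  by (rule linear_opI)
    (simp_all add: adjoint_op_eq_Some_iff [OF assms] cinner_add_right cinner_scaleC_right)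

lemma linear_op_uminus:
  assumes "linear_op S"
  shows "linear_op (uminus_op S)"
  unfolding uminus_op_def
  by (rule linear_opI)
    (auto simp: linear_opD [OF assms] complex_vector.scale_minus_right)

lemma block_op_eq_Some_iff:
  "block_op A B C D (u, v) = Some z \<longleftrightarrow>
    (\<exists>a b c d. A u = Some a \<and> B v = Some b \<and> C u = Some c \<and> D v = Some d \<and> z = (a + b, c + d))"
  unfolding block_op_def by auto

lemma linear_op_block:
  assumes "linear_op A" "linear_op B" "linear_op C" "linear_op D"
  shows "linear_op (block_op A B C D)"
proof (rule linear_opI)
  note lin = assms [THEN linear_opD(1)] assms [THEN linear_opD(2)] assms [THEN linear_opD(3)]
  let ?T = "block_op A B C D"
  show "?T 0 = Some 0"
    by (simp add: zero_prod_def block_op_eq_Some_iff lin)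
  show "?T (x + y) = Some (x' + y')" if "?T x = Some x'" "?T y = Some y'" for x y x' y'
    using that by (cases x; cases y) (auto simp: block_op_eq_Some_iff lin)
  show "?T (c *\<^sub>C x) = Some (c *\<^sub>C x')" if "?T x = Some x'" for c x x'
    using that
    by (cases x) (auto simp: block_op_eq_Some_iff lin scaleC_prod_def scaleC_add_right)
qed

lemma linear_op_hamiltonian: "hamiltonian A B C T \<Longrightarrow> linear_op T"
  unfolding hamiltonian_def by (auto intro: linear_op_block linear_op_uminus linear_op_adjoint)

text \<open>The contributions of \<open>A\<close> and \<open>- A\<^sup>*\<close> to the real part cancel.\<close>

lemma Re_J2_form_hamiltonian:
  assumes "hamiltonian A B C T" and "T (u, v) = Some z"
  shows "u \<in> dom C" "v \<in> dom B"
    and "Re (J2_form z (u, v)) = Re (cinner (the (C u)) u) + Re (cinner (the (B v)) v)"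
proof -
  from assms obtain a b c d where *:
    "A u = Some a" "B v = Some b" "C u = Some c" "adjoint_op A v = Some d" "z = (a + b, c - d)"
    unfolding hamiltonian_def uminus_op_def by (auto simp: block_op_eq_Some_iff)
  then show "u \<in> dom C" "v \<in> dom B" by auto
  have "densely_defined A" using assms(1) by (simp add: hamiltonian_def)
  then have "cinner a v = cinner u d"
    using * by (force simp: adjoint_op_eq_Some_iff)
  then have "Re (cinner a v) = Re (cinner d u)"
    using arg_cong [OF cinner_commute [of u d], of Re] by simp
  then show "Re (J2_form z (u, v)) = Re (cinner (the (C u)) u) + Re (cinner (the (B v)) v)"
    using * cinner_add_left [of c "- d" u]
    by (simp add: J2_form_def J2_def cinner_prod_def cinner_add_left cinner_minus_left)
qed

section \<open>The indefinite form of \<open>J2\<close>\<close>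

lemma J2_form_commute: "J2_form x y = cnj (J2_form y x)"
  using cinner_commute [of "snd x" "fst y"] cinner_commute [of "fst x" "snd y"]
  by (simp add: J2_form_def J2_def cinner_prod_def add.commute)

text \<open>The order on \<open>complex\<close> only compares numbers with equal imaginary parts, so
  every sign statement about the form also needs this.\<close>

lemma Im_J2_form_self: "Im (J2_form x x) = 0"
  using arg_cong [OF J2_form_commute [of x x], of Im] by simp

lemma bounded_linear_J2: "bounded_linear (J2 :: 'a \<times> 'a \<Rightarrow> 'a \<times> 'a::real_normed_vector)"
  unfolding J2_def by (intro bounded_linear_Pair bounded_linear_fst bounded_linear_snd)

lemma bounded_bilinear_Re_J2_form: "bounded_bilinear (\<lambda>x y. Re (J2_form x y))"
  unfolding J2_form_def
  by (rule bounded_bilinear.comp1 [OF bounded_bilinear_Re_cinner bounded_linear_J2])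

text \<open>Swapping the components is an isometry, so Cauchy-Schwarz transfers to the indefinite
  form.\<close>

lemma Re_J2_form_le: "Re (J2_form x y) \<le> norm x * norm y"
proof -
  have "norm (J2 x) = norm x"
    by (simp add: J2_def norm_prod_def add.commute)
  then show ?thesis
    unfolding J2_form_def by (metis Re_cinner_le)
qed

section \<open>Decaying orbits\<close>

text \<open>
  The initial values of the solutions of \<open>y' = - s T y\<close> that tend to \<open>0\<close> at infinity. The
  sign \<open>s = \<plusminus>1\<close> selects the half-plane.
\<close>

definition decaying_states :: "real \<Rightarrow> ('a::complex_inner \<rightharpoonup> 'a) \<Rightarrow> 'a set"
  where "decaying_states s T = {x. \<exists>y z. y 0 = x \<and>
    (\<forall>t. T (y t) = Some (z t) \<and> (y has_vector_derivative - s *\<^sub>R z t) (at t)) \<and>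
    (y \<longlongrightarrow> 0) at_top}"

text \<open>Superposition: sums and multiples of decaying orbits are decaying orbits of the same
  linear equation. Hence it suffices to find orbits for single root vectors.\<close>

lemma csubspace_decaying_states:
  assumes "linear_op T"
  shows "csubspace (decaying_states s T)"
  unfolding complex_vector.subspace_def
proof (intro conjI ballI allI)
  show "0 \<in> decaying_states s T"
    unfolding decaying_states_def mem_Collect_eq
    by (rule exI [of _ "\<lambda>_. 0"], rule exI [of _ "\<lambda>_. 0"]) (simp add: linear_opD [OF assms])
  show "x + x' \<in> decaying_states s T"
    if x: "x \<in> decaying_states s T" "x' \<in> decaying_states s T" for x x'
  proof -
    from x obtain y z y' z' where
      y: "y 0 = x" "\<And>t. T (y t) = Some (z t)"
        "\<And>t. (y has_vector_derivative - s *\<^sub>R z t) (at t)" "(y \<longlongrightarrow> 0) at_top" and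
      y': "y' 0 = x'" "\<And>t. T (y' t) = Some (z' t)"
        "\<And>t. (y' has_vector_derivative - s *\<^sub>R z' t) (at t)" "(y' \<longlongrightarrow> 0) at_top"
      unfolding decaying_states_def by blast
    have "((\<lambda>t. y t + y' t) has_vector_derivative - s *\<^sub>R (z t + z' t)) (at t)" for t
      using has_vector_derivative_add [OF y(3) y'(3)] by (simp add: scaleR_add_right)
    moreover have "((\<lambda>t. y t + y' t) \<longlongrightarrow> 0) at_top"
      using tendsto_add [OF y(4) y'(4)] by simp
    ultimately show ?thesis
      unfolding decaying_states_def mem_Collect_eq
      by (intro exI [of _ "\<lambda>t. y t + y' t"] exI [of _ "\<lambda>t. z t + z' t"])
        (simp add: linear_opD(2) [OF assms] y y')
  qed
  show "c *\<^sub>C x \<in> decaying_states s T" if x: "x \<in> decaying_states s T" for c x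
  proof -
    from x obtain y z where
      y: "y 0 = x" "\<And>t. T (y t) = Some (z t)"
        "\<And>t. (y has_vector_derivative - s *\<^sub>R z t) (at t)" "(y \<longlongrightarrow> 0) at_top"
      unfolding decaying_states_def by blast
    note lin = bounded_bilinear.bounded_linear_right [OF bounded_bilinear_scaleC, of c]
    have "((\<lambda>t. c *\<^sub>C y t) has_vector_derivative - s *\<^sub>R (c *\<^sub>C z t)) (at t)" for t
      using bounded_linear.has_vector_derivative [OF lin y(3)]
      by (simp add: scaleR_scaleC scaleC_scaleC mult.commute)
    moreover have "((\<lambda>t. c *\<^sub>C y t) \<longlongrightarrow> 0) at_top"
      using bounded_linear.tendsto [OF lin y(4)] by simp
    ultimately show ?thesis
      unfolding decaying_states_def mem_Collect_eq
      by (intro exI [of _ "\<lambda>t. c *\<^sub>C y t"] exI [of _ "\<lambda>t. c *\<^sub>C z t"])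
        (simp add: linear_opD(3) [OF assms] y)
  qed
qed

text \<open>Powers have their natural domain, so all intermediate iterates exist. Naming them
  provides the coefficient vectors of the orbit.\<close>

lemma pow_op_eq_SomeE:
  assumes "pow_op S n x = Some z"
  obtains f where "f 0 = x" "f n = z" "\<And>k. k < n \<Longrightarrow> S (f k) = Some (f (Suc k))"
proof -
  have "\<exists>f. f 0 = x \<and> f n = z \<and> (\<forall>k<n. S (f k) = Some (f (Suc k)))"
    using assms
  proof (induction n arbitrary: z)
    case 0
    then show ?case by auto
  next
    case (Suc n)
    then obtain w where "pow_op S n x = Some w" "S w = Some z"
      by (auto simp: map_comp_Some_iff)
    with Suc.IH obtain f where "f 0 = x" "f n = w" "\<forall>k<n. S (f k) = Some (f (Suc k))"
      by blast
    with \<open>S w = Some z\<close> show ?case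
      by (intro exI [of _ "f(Suc n := z)"]) (auto simp: less_Suc_eq)
  qed
  with that show thesis by blast
qed

lemma power_mult_exp_tendsto_0:
  fixes c :: real
  assumes "c > 0"
  shows "((\<lambda>t. exp (- c * t) * t ^ k) \<longlongrightarrow> 0) at_top"
proof -
  have "((\<lambda>t. (c * t) ^ k / exp (c * t)) \<longlongrightarrow> 0) at_top"
    by (rule filterlim_compose [OF tendsto_power_div_exp_0])
      (use assms in \<open>simp add: filterlim_tendsto_pos_mult_at_top [OF tendsto_const _ filterlim_ident]\<close>)
  from tendsto_mult_right_zero [OF this, of "1 / c ^ k"] show ?thesis
    using assms by (simp add: power_mult_distrib exp_minus field_simps)
qed

text \<open>
  If \<open>(T - \<mu>)\<^sup>n x = 0\<close>, the orbit is the finite exponential sum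
  \<open>y t = e\<^bsup>-s\<mu>t\<^esup> (\<Sum>k<n. (-s t)\<^sup>k/k! (T - \<mu>)\<^sup>k x)\<close>.
\<close>

lemma root_space_subset_decaying_states:
  assumes T: "linear_op T" and \<mu>: "s * Re \<mu> > 0"
  shows "root_space T \<mu> \<subseteq> decaying_states s T"
proof
  fix x assume "x \<in> root_space T \<mu>"
  then obtain n where "pow_op (shift_op T \<mu>) n x = Some 0"
    unfolding root_space_def ker_op_def by blast
  then obtain f where f: "f 0 = x" "f n = 0"
    and shift: "\<And>k. k < n \<Longrightarrow> shift_op T \<mu> (f k) = Some (f (Suc k))"
    by (rule pow_op_eq_SomeE) blast
  have Tf: "T (f k) = Some (f (Suc k) + \<mu> *\<^sub>C f k)" if "k < n" for k
    using shift [OF that] unfolding shift_op_def by (auto simp: algebra_simps)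
  \<comment> \<open>Here \<open>v t\<close> is \<open>(T - \<mu>)\<close> applied to
    \<open>w t\<close>. Since the derivative of \<open>p (Suc k)\<close> is
    \<open>- s * p k\<close>, \<open>w\<close> solves the equation for the nilpotent part, and the
    factor \<open>E\<close> accounts for \<open>\<mu>\<close>.\<close>
  define p where "p k t = (- s * t) ^ k / fact k" for k :: nat and t :: real
  define w where "w t = (\<Sum>k<n. p k t *\<^sub>R f k)" for t
  define v where "v t = (\<Sum>k<n. p k t *\<^sub>R f (Suc k))" for t
  define E where "E t = exp (t *\<^sub>R (- (s *\<^sub>R \<mu>)))" for t :: real
  have p0: "(p 0 has_real_derivative 0) (at t)" for t
    unfolding p_def [abs_def] power_0 by (rule DERIV_const)
  have pSuc: "(p (Suc k) has_real_derivative - s * p k t) (at t)" for k t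
  proof -
    have "((\<lambda>t. (- s * t) ^ Suc k / fact (Suc k)) has_real_derivative
        (real (Suc k) * (- s * t) ^ k * (- s)) / fact (Suc k)) (at t)"
      by (rule derivative_eq_intros refl | simp)+
    also have "(real (Suc k) * (- s * t) ^ k * (- s)) / fact (Suc k) = - s * p k t"
      unfolding p_def fact_Suc of_nat_mult
      by (simp del: of_nat_Suc)
    finally show ?thesis by (simp only: p_def [abs_def])
  qed
  have dw: "(w has_vector_derivative - s *\<^sub>R v t) (at t)" for t
  proof -
    define d where "d k = (case k of 0 \<Rightarrow> 0 | Suc j \<Rightarrow> - s * p j t)" for k
    have "(p k has_real_derivative d k) (at t)" for k
      by (cases k) (use p0 pSuc in \<open>simp_all add: d_def\<close>)
    then have "(w has_vector_derivative (\<Sum>k<n. d k *\<^sub>R f k)) (at t)"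
      unfolding w_def
      by (intro has_vector_derivative_sum)
        (auto intro!: derivative_eq_intros)
    \<comment> \<open>The extra term vanishes because \<open>f n = 0\<close>. With it, splitting off
      index 0 and shifting the others leaves exactly the \<open>n\<close> terms of
      \<open>v t\<close>.\<close>
    also have "(\<Sum>k<n. d k *\<^sub>R f k) = (\<Sum>k<Suc n. d k *\<^sub>R f k)"
      by (simp add: f)
    also have "\<dots> = - s *\<^sub>R v t"
      unfolding v_def
      by (subst sum.lessThan_Suc_shift) (simp add: d_def scaleR_sum_right)
    finally show ?thesis .
  qed
  have dE: "(E has_vector_derivative E t * (- (s *\<^sub>R \<mu>))) (at t)" for t
    unfolding E_def by (rule exp_scaleR_has_vector_derivative_right)
  have Tw: "T (w t) = Some (v t + \<mu> *\<^sub>C w t)" for t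
  proof -
    have "T (w t) = Some (\<Sum>k<n. complex_of_real (p k t) *\<^sub>C (f (Suc k) + \<mu> *\<^sub>C f k))"
      unfolding w_def scaleR_scaleC by (rule linear_op_sum [OF T]) (simp add: Tf)
    also have "(\<Sum>k<n. complex_of_real (p k t) *\<^sub>C (f (Suc k) + \<mu> *\<^sub>C f k)) = v t + \<mu> *\<^sub>C w t"
      by (simp add: v_def w_def scaleR_scaleC scaleC_add_right sum.distrib scaleC_scaleC
          complex_vector.scale_sum_right mult.commute)
    finally show ?thesis .
  qed
  define y where "y t = E t *\<^sub>C w t" for t
  define z where "z t = E t *\<^sub>C (v t + \<mu> *\<^sub>C w t)" for t
  have "T (y t) = Some (z t)" for t
    unfolding y_def z_def by (rule linear_opD(3) [OF T Tw])
  moreover have "(y has_vector_derivative - s *\<^sub>R z t) (at t)" for t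
  proof -
    have "(y has_vector_derivative E t *\<^sub>C (- s *\<^sub>R v t) + (E t * (- (s *\<^sub>R \<mu>))) *\<^sub>C w t) (at t)"
      unfolding y_def
      by (rule bounded_bilinear.has_vector_derivative [OF bounded_bilinear_scaleC dE dw])
    also have "E t *\<^sub>C (- s *\<^sub>R v t) + (E t * (- (s *\<^sub>R \<mu>))) *\<^sub>C w t = - s *\<^sub>R z t"
      by (simp add: z_def scaleR_scaleC [where 'a = 'a] scaleC_add_right scaleC_scaleC
          complex_vector.scale_minus_left complex_vector.scale_minus_right scaleR_conv_of_real
          mult_ac)
    finally show ?thesis .
  qed
  moreover have "(y \<longlongrightarrow> 0) at_top"
  proof -
    \<comment> \<open>\<open>E t\<close> has modulus \<open>exp (- (s * Re \<mu>) * t)\<close> with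
      \<open>s * Re \<mu> > 0\<close>, so it beats each of the finitely many powers of
      \<open>t\<close>.\<close>
    have "((\<lambda>t. \<Sum>k<n. norm (E t * p k t) * norm (f k)) \<longlongrightarrow> 0) at_top"
    proof (intro tendsto_null_sum tendsto_mult_left_zero tendsto_norm_zero)
      fix k
      have "((\<lambda>t. exp (- (s * Re \<mu>) * t) * t ^ k * ((- s) ^ k / fact k)) \<longlongrightarrow> 0) at_top"
        by (intro tendsto_mult_left_zero power_mult_exp_tendsto_0 \<mu>)
      then have "((\<lambda>t. norm (exp (- (s * Re \<mu>) * t) * t ^ k * ((- s) ^ k / fact k))) \<longlongrightarrow> 0) at_top"
        by (rule tendsto_norm_zero)
      also have "(\<lambda>t. norm (exp (- (s * Re \<mu>) * t) * t ^ k * ((- s) ^ k / fact k))) =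
          (\<lambda>t. norm (E t * p k t))"
        by (simp add: fun_eq_iff E_def p_def norm_mult norm_divide norm_power power_mult_distrib
            abs_mult power_abs mult_ac)
      finally show "((\<lambda>t. E t * p k t) \<longlongrightarrow> 0) at_top"
        by (rule tendsto_norm_zero_cancel)
    qed
    moreover have "norm (y t) \<le> (\<Sum>k<n. norm (E t * p k t) * norm (f k))" for t
      unfolding y_def w_def complex_vector.scale_sum_right
      by (intro sum_norm_le) (simp add: scaleR_scaleC norm_scaleC norm_mult)
    ultimately show ?thesis
      by (intro Lim_null_comparison [where f = y]) auto
  qed
  moreover have "y 0 = x"
  \<comment> \<open>For \<open>n = 0\<close> the sum is empty and \<open>x = f 0 = f n = 0\<close>;
    otherwise only the term \<open>k = 0\<close> survives at time 0.\<close>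
  proof (cases n)
    case 0
    with f show ?thesis by (simp add: y_def w_def)
  next
    case (Suc m)
    then show ?thesis
      unfolding y_def w_def Suc sum.lessThan_Suc_shift
      by (simp add: p_def E_def f)
  qed
  ultimately show "x \<in> decaying_states s T"
    unfolding decaying_states_def by blast
qed

text \<open>The form is antitone along the orbits and vanishes at infinity.\<close>

lemma form_nonneg_on_decaying_states:
  fixes b :: "'a::complex_inner \<Rightarrow> 'a \<Rightarrow> real"
  assumes b: "bounded_bilinear b" "\<And>x y. b x y = b y x"
    and T: "\<And>x z. T x = Some z \<Longrightarrow> s * b z x \<ge> 0"
    and x: "x \<in> decaying_states s T"
  shows "b x x \<ge> 0"
proof -
  interpret bounded_bilinear b by (fact b)
  from x obtain y z where
    y: "y 0 = x" "\<And>t. T (y t) = Some (z t)"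
      "\<And>t. (y has_vector_derivative - s *\<^sub>R z t) (at t)" "(y \<longlongrightarrow> 0) at_top"
    unfolding decaying_states_def by blast
  have "((\<lambda>t. b (y t) (y t)) has_real_derivative - 2 * (s * b (z t) (y t))) (at t)" for t
  proof -
    have "b (y t) (- s *\<^sub>R z t) + b (- s *\<^sub>R z t) (y t) = - 2 * (s * b (z t) (y t))"
      by (simp add: b(2) [of "y t" "z t"] scaleR_left scaleR_right minus_left minus_right)
    with has_vector_derivative [OF y(3) y(3), of t] show ?thesis
      by (simp add: has_real_derivative_iff_has_vector_derivative)
  qed
  then have "b (y t) (y t) \<le> b (y 0) (y 0)" if "t \<ge> 0" for t
    using that T [OF y(2)]
    by (intro DERIV_nonpos_imp_nonincreasing [of 0 t "\<lambda>t. b (y t) (y t)"]) fastforce+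
  moreover have "((\<lambda>t. b (y t) (y t)) \<longlongrightarrow> 0) at_top"
    using tendsto [OF y(4) y(4)] by (simp add: zero_left)
  ultimately have "0 \<le> b (y 0) (y 0)"
    by (intro tendsto_upperbound) (auto intro: eventually_mono [OF eventually_ge_at_top [of 0]])
  then show ?thesis by (simp add: y)
qed

text \<open>The decaying states form a subspace containing the root spaces, hence their span. Points
  of the closure may leave the domain of \<open>T\<close>, so there only the values of the
  continuous form are passed to the limit.\<close>

lemma form_nonneg_on_root_sum_closure:
  fixes b :: "'a::complex_inner \<Rightarrow> 'a \<Rightarrow> real"
  assumes "bounded_bilinear b" "\<And>x y. b x y = b y x" "linear_op T"
    and "\<And>x z. T x = Some z \<Longrightarrow> s * b z x \<ge> 0"
    and \<Lambda>: "\<And>\<mu>. \<mu> \<in> \<Lambda> \<Longrightarrow> s * Re \<mu> > 0"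
    and x: "x \<in> root_sum_closure T \<Lambda>"
  shows "b x x \<ge> 0"
proof -
  have "cspan (\<Union>\<mu>\<in>\<Lambda>. root_space T \<mu>) \<subseteq> decaying_states s T"
    using root_space_subset_decaying_states [OF assms(3) \<Lambda>]
    by (intro complex_vector.span_minimal csubspace_decaying_states assms) blast
  moreover obtain f where "\<And>n. f n \<in> cspan (\<Union>\<mu>\<in>\<Lambda>. root_space T \<mu>)" "f \<longlonglongrightarrow> x"
    using x unfolding root_sum_closure_def closure_sequential by blast
  ultimately have "\<And>n. b (f n) (f n) \<ge> 0" "(\<lambda>n. b (f n) (f n)) \<longlonglongrightarrow> b x x"
    using form_nonneg_on_decaying_states [OF assms(1,2,4)]
    by (blast, intro bounded_bilinear.tendsto [OF assms(1)])
  then show ?thesis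
    by (intro LIMSEQ_le_const) auto
qed

section \<open>Riesz bases of Jordan chains\<close>

text \<open>Coefficients are attached to indices, not to vectors. Choosing \<open>K\<close> with
  \<open>v\<close> injective on it lets the sum over vectors be reindexed even if \<open>v\<close>
  repeats values on \<open>I\<close>.\<close>

lemma cspan_image_explicit:
  fixes v :: "'i \<Rightarrow> 'a::complex_inner"
  assumes "x \<in> cspan (v ` I)"
  obtains K c where "finite K" "K \<subseteq> I" "x = (\<Sum>i\<in>K. c i *\<^sub>C v i)"
proof -
  from assms obtain t r where t: "finite t" "t \<subseteq> v ` I" "x = (\<Sum>a\<in>t. r a *\<^sub>C a)"
    unfolding complex_vector.span_explicit by blast
  from t(2) obtain K where K: "K \<subseteq> I" "inj_on v K" "t = v ` K"
    unfolding subset_image_inj by blast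
  with t have "finite K" "x = (\<Sum>i\<in>K. r (v i) *\<^sub>C v i)"
    by (auto simp: sum.reindex finite_image_iff)
  with K(1) show thesis by (intro that)
qed

text \<open>In an orthonormal basis, the nilpotent part of a Jordan matrix is a partial shift.\<close>

lemma abs_Re_cinner_jordan_le:
  fixes e :: "'j \<times> nat \<Rightarrow> 'a::complex_inner" and \<mu> :: "'j \<Rightarrow> complex"
  assumes I: "\<And>j k. (j, Suc k) \<in> I \<Longrightarrow> (j, k) \<in> I"
    and e: "\<And>i i'. i \<in> I \<Longrightarrow> i' \<in> I \<Longrightarrow> cinner (e i) (e i') = (if i = i' then 1 else 0)"
    and \<mu>: "\<And>i. i \<in> I \<Longrightarrow> \<bar>Re (\<mu> (fst i))\<bar> \<le> a"
    and K: "finite K" "K \<subseteq> I"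
    and w: "\<And>j. w (j, 0) = \<mu> j *\<^sub>C e (j, 0)"
      "\<And>j k. w (j, Suc k) = \<mu> j *\<^sub>C e (j, Suc k) + e (j, k)"
    and x: "x = (\<Sum>i\<in>K. c i *\<^sub>C e i)" and z: "z = (\<Sum>i\<in>K. c i *\<^sub>C w i)"
  shows "\<bar>Re (cinner z x)\<bar> \<le> (a + 1) * (norm x)\<^sup>2"
proof -
  \<comment> \<open>The predecessor of an index in \<open>K\<close> may lie outside
    \<open>K\<close>, hence the extension of \<open>c\<close> by zero. \<open>d\<close> is the
    coefficient of the predecessor, with value 0 at the head of a chain.\<close>
  define c' where "c' i = (if i \<in> K then c i else 0)" for i
  define d where "d i = (case i of (j, 0) \<Rightarrow> 0 | (j, Suc k) \<Rightarrow> c' (j, k))" for i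
  have ex: "cinner (e i) x = cnj (c' i)" if "i \<in> I" for i
  proof -
    have "cinner (e i) x = (\<Sum>i'\<in>K. if i = i' then cnj (c i') else 0)"
      unfolding x cinner_sum_right cinner_scaleC_right
      by (intro sum.cong refl) (simp add: e [OF that] subsetD [OF K(2)])
    then show ?thesis
      using K by (simp add: c'_def)
  qed
  have "cinner x x = (\<Sum>i\<in>K. c i * cnj (c i))"
    by (subst (1) x, unfold cinner_sum_left cinner_scaleC_left, intro sum.cong refl)
      (use K in \<open>auto simp: ex subset_iff c'_def\<close>)
  then have "complex_of_real ((norm x)\<^sup>2) = complex_of_real (\<Sum>i\<in>K. (cmod (c i))\<^sup>2)"
    unfolding cinner_self by (simp add: complex_norm_square [symmetric])
  then have norm_x: "(norm x)\<^sup>2 = (\<Sum>i\<in>K. (cmod (c i))\<^sup>2)"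
    by (simp only: of_real_eq_iff)
  have wx: "cinner (w i) x = \<mu> (fst i) * cnj (c i) + cnj (d i)" if "i \<in> K" for i
  proof -
    obtain j k where i: "i = (j, k)" by (cases i)
    with that K I show ?thesis
      by (cases k)
        (auto simp: w d_def cinner_add_left cinner_scaleC_left ex subset_iff c'_def)
  qed
  \<comment> \<open>The cross term \<open>cmod (c i) * cmod (d i)\<close> is at most half the sum of
    the squares. One half is added to \<open>a\<close>; the other is summed separately and bounded
    by the norm of \<open>x\<close>, which gives \<open>a + 1\<close> in total.\<close>
  have "\<bar>Re (c i * cinner (w i) x)\<bar> \<le> (a + 1/2) * (cmod (c i))\<^sup>2 + 1/2 * (cmod (d i))\<^sup>2"
    if "i \<in> K" for i
  proof -
    have "Re (c i * cinner (w i) x) = Re (\<mu> (fst i)) * (cmod (c i))\<^sup>2 + Re (c i * cnj (d i))"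
      unfolding wx [OF that] cmod_power2 by (simp add: algebra_simps power2_eq_square)
    moreover have "\<bar>Re (\<mu> (fst i)) * (cmod (c i))\<^sup>2\<bar> \<le> a * (cmod (c i))\<^sup>2"
      using mult_right_mono [OF \<mu> [OF subsetD [OF K(2) that]], of "(cmod (c i))\<^sup>2"]
      by (simp add: abs_mult)
    moreover have "\<bar>Re (c i * cnj (d i))\<bar> \<le> cmod (c i) * cmod (d i)"
      by (metis abs_Re_le_cmod complex_mod_cnj norm_mult)
    moreover have "2 * (cmod (c i) * cmod (d i)) \<le> (cmod (c i))\<^sup>2 + (cmod (d i))\<^sup>2"
      using sum_squares_bound [of "cmod (c i)" "cmod (d i)"] by simp
    ultimately show ?thesis by (simp add: algebra_simps)
  qed
  then have "\<bar>Re (cinner z x)\<bar> \<le>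
      (\<Sum>i\<in>K. (a + 1/2) * (cmod (c i))\<^sup>2 + 1/2 * (cmod (d i))\<^sup>2)"
    unfolding z cinner_sum_left cinner_scaleC_left Re_sum
    by (intro order_trans [OF sum_abs] sum_mono)
  also have "\<dots> = (a + 1/2) * (norm x)\<^sup>2 + 1/2 * (\<Sum>i\<in>K. (cmod (d i))\<^sup>2)"
    by (simp add: norm_x sum.distrib sum_distrib_left)
  also have "(\<Sum>i\<in>K. (cmod (d i))\<^sup>2) \<le> (norm x)\<^sup>2"
  proof -
    \<comment> \<open>Within \<open>K\<close>, \<open>d\<close> can be nonzero only at successors of
      indices in \<open>K'\<close>. Reindexing along \<open>?succ\<close> turns its square sum into
      a partial sum of \<open>(norm x)\<^sup>2\<close>.\<close>
    define K' where "K' = {i \<in> K. (fst i, Suc (snd i)) \<in> K}"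
    let ?succ = "\<lambda>i. (fst i, Suc (snd i))"
    have "(\<Sum>i\<in>K. (cmod (d i))\<^sup>2) = (\<Sum>i\<in>?succ ` K'. (cmod (d i))\<^sup>2)"
    proof (rule sum.mono_neutral_right)
      show "\<forall>i\<in>K - ?succ ` K'. (cmod (d i))\<^sup>2 = 0"
      proof
        fix i assume "i \<in> K - ?succ ` K'"
        moreover obtain j k where "i = (j, k)" by (cases i)
        ultimately show "(cmod (d i))\<^sup>2 = 0"
          by (cases k) (force simp: d_def c'_def K'_def)+
      qed
    qed (use K in \<open>auto simp: K'_def\<close>)
    also have "\<dots> = (\<Sum>i\<in>K'. (cmod (c i))\<^sup>2)"
      by (subst sum.reindex) (auto simp: inj_on_def d_def c'_def K'_def intro!: sum.cong)
    also have "\<dots> \<le> (\<Sum>i\<in>K. (cmod (c i))\<^sup>2)"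
      using K by (intro sum_mono2) (auto simp: K'_def)
    finally show ?thesis by (simp only: norm_x)
  qed
  finally show ?thesis by (simp add: algebra_simps)
qed

lemma isomorphism_inv_scaleC: "isomorphism \<Phi> \<Longrightarrow> inv \<Phi> (c *\<^sub>C x) = c *\<^sub>C inv \<Phi> x"
  unfolding isomorphism_def by (metis bij_inv_eq_iff)

text \<open>The vectors that \<open>inv \<Phi>\<close> sends into the span form a subspace
  containing the orthonormal basis; continuity of \<open>inv \<Phi>\<close> then carries density
  back.\<close>

lemma closure_cspan_riesz_basis:
  assumes \<Phi>: "isomorphism \<Phi>" and onb: "orthonormal_basis I (\<lambda>i. \<Phi> (v i))"
  shows "closure (cspan (v ` I)) = UNIV"
proof -
  have inv: "bounded_linear (inv \<Phi>)" "inv \<Phi> (\<Phi> x) = x" for x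
    using \<Phi> unfolding isomorphism_def by (auto simp: bij_is_inj)
  let ?F = "cspan (v ` I)"
  have "csubspace {y. inv \<Phi> y \<in> ?F}"
    unfolding complex_vector.subspace_def
    using linear_0 [OF bounded_linear.linear [OF inv(1)]]
    by (auto simp: linear_add [OF bounded_linear.linear [OF inv(1)]] isomorphism_inv_scaleC [OF \<Phi>]
        intro: complex_vector.span_add complex_vector.span_scale complex_vector.span_zero)
  then have sub: "cspan ((\<lambda>i. \<Phi> (v i)) ` I) \<subseteq> {y. inv \<Phi> y \<in> ?F}"
    by (intro complex_vector.span_minimal) (auto simp: inv intro: complex_vector.span_base)
  have "x \<in> closure ?F" for x
  proof -
    have "\<Phi> x \<in> closure (cspan ((\<lambda>i. \<Phi> (v i)) ` I))"
      using onb by (simp add: orthonormal_basis_def)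
    then obtain f where f: "\<And>n. f n \<in> cspan ((\<lambda>i. \<Phi> (v i)) ` I)" "f \<longlonglongrightarrow> \<Phi> x"
      unfolding closure_sequential by blast
    have "(\<lambda>n. inv \<Phi> (f n)) \<longlonglongrightarrow> x"
      using bounded_linear.tendsto [OF inv(1) f(2)] by (simp add: inv)
    moreover have "\<forall>n. inv \<Phi> (f n) \<in> ?F" using f sub by blast
    ultimately show ?thesis unfolding closure_sequential by (intro exI conjI)
  qed
  then show ?thesis by blast
qed

text \<open>
  On the span \<open>F\<close> of the chains the estimate is an explicit computation. Since \<open>T\<close> maps \<open>F\<close>
  onto itself and is bounded below, the graph of \<open>T\<close> is contained in the closure of its
  restriction to \<open>F\<close>, whence the estimate extends to the whole domain of \<open>T\<close>.
\<close>

lemma abs_Re_cinner_riesz_jordan_le: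
  fixes T :: "'a::complex_inner \<rightharpoonup> 'a" and xs :: "'j \<Rightarrow> 'a list"
  defines "I \<equiv> \<lambda>J. SIGMA j:J. {..<length (xs j)}"
    and "v \<equiv> \<lambda>(j, k). xs j ! k"
  assumes T: "linear_op T"
    and chain: "\<And>j. j \<in> J \<Longrightarrow> jordan_chain T (\<mu> j) (xs j)"
    and \<Phi>: "isomorphism \<Phi>" and onb: "orthonormal_basis (I J) (\<lambda>i. \<Phi> (v i))"
    and a: "\<And>\<nu>. \<nu> \<in> point_spectrum T \<Longrightarrow> \<bar>Re \<nu>\<bar> \<le> a"
    and nz: "0 \<notin> point_spectrum T"
    and \<gamma>: "\<gamma> > 0" "\<And>x z. T x = Some z \<Longrightarrow> \<gamma> * norm x \<le> norm z"
    and x: "T x = Some z"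
  shows "\<bar>Re (cinner (\<Phi> z) (\<Phi> x))\<bar> \<le> (a + 1) * (norm (\<Phi> x))\<^sup>2"
proof -
  \<comment> \<open>\<open>w i\<close> is the value of \<open>T\<close> at the basis vector
    \<open>v i\<close>, as dictated by the chain relations.\<close>
  define w where "w i = (case i of (j, 0) \<Rightarrow> \<mu> j *\<^sub>C v (j, 0)
    | (j, Suc k) \<Rightarrow> \<mu> j *\<^sub>C v (j, Suc k) + v (j, k))" for i
  define F where "F = cspan (v ` I J)"
  have lin: "bounded_linear \<Phi>" and \<Phi>_scale: "\<Phi> (c *\<^sub>C y) = c *\<^sub>C \<Phi> y" for c y
    using \<Phi> by (auto simp: isomorphism_def)
  have \<Phi>_add: "\<Phi> (y + y') = \<Phi> y + \<Phi> y'" for y y'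
    by (rule linear_add [OF bounded_linear.linear [OF lin]])
  have \<Phi>_sum: "\<Phi> (\<Sum>i\<in>K. c i *\<^sub>C u i) = (\<Sum>i\<in>K. c i *\<^sub>C \<Phi> (u i))" for K c and u :: "'j \<times> nat \<Rightarrow> 'a"
    by (simp add: linear_sum [OF bounded_linear.linear [OF lin]] \<Phi>_scale)
  have e: "cinner (\<Phi> (v i)) (\<Phi> (v i')) = (if i = i' then 1 else 0)"
    if "i \<in> I J" "i' \<in> I J" for i i'
    using onb that by (simp add: orthonormal_basis_def)
  have Tv: "T (v i) = Some (w i)" if i_in: "i \<in> I J" for i
  proof -
    obtain j k where i: "i = (j, k)" "j \<in> J" "k < length (xs j)"
      using i_in by (auto simp: I_def)
    note ch = chain [OF i(2), unfolded jordan_chain_def shift_op_def]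
    show ?thesis
    proof (cases k)
      case 0
      with i ch show ?thesis
        by (auto simp: v_def w_def algebra_simps)
    next
      case (Suc m)
      with i ch show ?thesis
        by (auto simp: v_def w_def diff_eq_eq add.commute)
    qed
  qed
  \<comment> \<open>A chain as defined could start with the zero vector; here its head is nonzero
    because \<open>\<Phi>\<close> maps it to a unit vector.\<close>
  have \<mu>: "\<mu> (fst i) \<in> point_spectrum T" if "i \<in> I J" for i
  proof -
    obtain j k where i: "i = (j, k)" by (cases i)
    with that have j0: "(j, 0) \<in> I J" by (auto simp: I_def)
    from e [OF this this] have "v (j, 0) \<noteq> 0"
      using linear_0 [OF bounded_linear.linear [OF lin]] by auto
    with Tv [OF j0] i show ?thesis
      by (auto simp: point_spectrum_def w_def)
  qed
  have on_F: "\<exists>z. T y = Some z \<and> \<bar>Re (cinner (\<Phi> z) (\<Phi> y))\<bar> \<le> (a + 1) * (norm (\<Phi> y))\<^sup>2"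
    if "y \<in> F" for y
  proof -
    from that obtain K c where K: "finite K" "K \<subseteq> I J" and y: "y = (\<Sum>i\<in>K. c i *\<^sub>C v i)"
      unfolding F_def by (rule cspan_image_explicit)
    have Ty: "T y = Some (\<Sum>i\<in>K. c i *\<^sub>C w i)"
      unfolding y using K by (intro linear_op_sum [OF T] Tv) auto
    have "\<bar>Re (cinner (\<Phi> (\<Sum>i\<in>K. c i *\<^sub>C w i)) (\<Phi> y))\<bar> \<le> (a + 1) * (norm (\<Phi> y))\<^sup>2"
    proof (rule abs_Re_cinner_jordan_le [where w = "\<lambda>i. \<Phi> (w i)" and \<mu> = \<mu> and c = c,
          OF _ e _ K])
      show "\<bar>Re (\<mu> (fst i))\<bar> \<le> a" if "i \<in> I J" for i
        using a \<mu> [OF that] by blast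
    qed (auto simp: y \<Phi>_sum \<Phi>_add \<Phi>_scale w_def I_def)
    with Ty show ?thesis by blast
  qed
  \<comment> \<open>Preimages are built along each chain: given \<open>u\<close> with
    \<open>T u = v (j, k)\<close>, the vector \<open>(v (j, Suc k) - u) / \<mu> j\<close> is mapped
    to \<open>v (j, Suc k)\<close>. Division is possible because 0 is not an eigenvalue.\<close>
  have surj: "\<exists>u\<in>F. T u = Some y" if "y \<in> F" for y
  proof -
    have "csubspace {y. \<exists>u\<in>F. T u = Some y}"
      unfolding complex_vector.subspace_def F_def
      by (auto intro: complex_vector.span_add complex_vector.span_scale complex_vector.span_zero
          linear_opD [OF T] bexI [rotated])
    moreover have "\<exists>u\<in>F. T u = Some (v (j, k))" if "(j, k) \<in> I J" for j k
      using that
    proof (induction k)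
      have F: "v i \<in> F" if "i \<in> I J" for i
        using that unfolding F_def by (intro complex_vector.span_base imageI)
      have \<mu>j: "\<mu> j \<noteq> 0" if "(j, k) \<in> I J" for k
        using \<mu> [OF that] nz by auto
      {
        case 0
        have "T (inverse (\<mu> j) *\<^sub>C v (j, 0)) = Some (v (j, 0))"
          using linear_opD(3) [OF T Tv [OF 0], of "inverse (\<mu> j)"] \<mu>j [OF 0]
          by (simp add: w_def scaleC_scaleC)
        then show ?case
          using F [OF 0] unfolding F_def by (blast intro: complex_vector.span_scale)
      next
        case (Suc k)
        then have "(j, k) \<in> I J" by (auto simp: I_def)
        from Suc.IH [OF this] obtain u where u: "u \<in> F" "T u = Some (v (j, k))" by blast
        have "T (inverse (\<mu> j) *\<^sub>C (v (j, Suc k) - u)) = Some (v (j, Suc k))"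
          using linear_opD(3) [OF T linear_op_diff [OF T Tv [OF Suc.prems] u(2)], of "inverse (\<mu> j)"]
            \<mu>j [OF Suc.prems]
          by (simp add: w_def scaleC_scaleC)
        then show ?case
          using F [OF Suc.prems] u(1) unfolding F_def
          by (blast intro: complex_vector.span_scale complex_vector.span_diff)
      }
    qed
    ultimately have "F \<subseteq> {y. \<exists>u\<in>F. T u = Some y}"
      unfolding F_def by (intro complex_vector.span_minimal) (auto simp: F_def)
    with that show ?thesis by blast
  qed
  \<comment> \<open>The approximation starts from the value \<open>z\<close>, not from
    \<open>x\<close>: approximants of \<open>z\<close> in \<open>F\<close> are pulled back to
    \<open>y n\<close> in \<open>F\<close>, and the lower bound on \<open>T\<close> forces
    \<open>y n\<close> to converge to \<open>x\<close>.\<close>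
  have "z \<in> closure F"
    unfolding F_def closure_cspan_riesz_basis [OF \<Phi> onb] by simp
  then obtain g where g: "\<And>n. g n \<in> F" "g \<longlonglongrightarrow> z"
    unfolding closure_sequential by blast
  have "\<forall>n. \<exists>u. u \<in> F \<and> T u = Some (g n)"
    using surj [OF g(1)] by blast
  from choice [OF this] obtain y where y: "\<And>n. y n \<in> F" "\<And>n. T (y n) = Some (g n)"
    by blast
  have "norm (y n - x) \<le> norm (g n - z) / \<gamma>" for n
    using \<gamma>(2) [OF linear_op_diff [OF T y(2) x], of n] \<gamma>(1) by (simp add: field_simps)
  moreover have "(\<lambda>n. norm (g n - z) / \<gamma>) \<longlonglongrightarrow> 0"
    by (intro tendsto_divide_zero tendsto_norm_zero LIM_zero g)
  ultimately have "(\<lambda>n. y n - x) \<longlonglongrightarrow> 0"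
    by (intro Lim_null_comparison [where f = "\<lambda>n. y n - x"]) auto
  then have "y \<longlonglongrightarrow> x" by (rule LIM_zero_cancel)
  have \<Phi>y: "(\<lambda>n. \<Phi> (y n)) \<longlonglongrightarrow> \<Phi> x" and \<Phi>g: "(\<lambda>n. \<Phi> (g n)) \<longlonglongrightarrow> \<Phi> z"
    using \<open>y \<longlonglongrightarrow> x\<close> g(2) by (auto intro: bounded_linear.tendsto [OF lin])
  show ?thesis
  proof (rule LIMSEQ_le)
    show "(\<lambda>n. \<bar>Re (cinner (\<Phi> (g n)) (\<Phi> (y n)))\<bar>) \<longlonglongrightarrow> \<bar>Re (cinner (\<Phi> z) (\<Phi> x))\<bar>"
      by (intro tendsto_rabs bounded_bilinear.tendsto [OF bounded_bilinear_Re_cinner] \<Phi>y \<Phi>g)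
    show "(\<lambda>n. (a + 1) * (norm (\<Phi> (y n)))\<^sup>2) \<longlonglongrightarrow> (a + 1) * (norm (\<Phi> x))\<^sup>2"
      by (intro tendsto_intros \<Phi>y)
    show "\<exists>N. \<forall>n\<ge>N. \<bar>Re (cinner (\<Phi> (g n)) (\<Phi> (y n)))\<bar> \<le> (a + 1) * (norm (\<Phi> (y n)))\<^sup>2"
      using on_F [OF y(1)] by (simp add: y(2))
  qed
qed

text \<open>
  The form \<open>s [x|x] - \<beta> \<parallel>\<Phi> x\<parallel>\<^sup>2\<close> is still dissipative for small \<open>\<beta> > 0\<close>.
\<close>

lemma uniform_bound_on_root_sum_closure:
  fixes T :: "'h::complex_inner \<times> 'h \<rightharpoonup> 'h \<times> 'h"
  assumes T: "linear_op T"
    and \<gamma>: "\<gamma> > 0" "\<And>x z. T x = Some z \<Longrightarrow> \<gamma> * (norm x)\<^sup>2 \<le> Re (J2_form z x)"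
    and basis: "has_riesz_basis_of_jordan_chains T"
    and a: "a \<ge> 0" "\<And>\<mu>. \<mu> \<in> point_spectrum T \<Longrightarrow> \<bar>Re \<mu>\<bar> \<le> a"
    and nz: "0 \<notin> point_spectrum T"
    and s: "\<bar>s\<bar> = 1" and \<Lambda>: "\<And>\<mu>. \<mu> \<in> \<Lambda> \<Longrightarrow> s * Re \<mu> > 0"
  obtains \<alpha> where "\<alpha> > 0"
    "\<And>x. x \<in> root_sum_closure T \<Lambda> \<Longrightarrow> \<alpha> * (norm x)\<^sup>2 \<le> s * Re (J2_form x x)"
proof -
  from basis obtain J :: "nat set" and \<mu> xs \<Phi>
    where chain: "\<And>j. j \<in> J \<Longrightarrow> jordan_chain T (\<mu> j) (xs j)"
      and \<Phi>: "isomorphism \<Phi>"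
      and onb: "orthonormal_basis (SIGMA j:J. {..<length (xs j)}) (\<lambda>i. \<Phi> ((\<lambda>(j, k). xs j ! k) i))"
    unfolding has_riesz_basis_of_jordan_chains_def riesz_basis_def by blast
  from \<Phi> have lin: "bounded_linear \<Phi>" "bounded_linear (inv \<Phi>)" and inv: "inv \<Phi> (\<Phi> x) = x" for x
    unfolding isomorphism_def by (auto simp: bij_is_inj)
  obtain M where M: "M > 0" "\<And>x. norm (\<Phi> x) \<le> norm x * M"
    using bounded_linear.pos_bounded [OF lin(1)] by blast
  obtain K where K: "K > 0" "\<And>x. norm (inv \<Phi> x) \<le> norm x * K"
    using bounded_linear.pos_bounded [OF lin(2)] by blast
  \<comment> \<open>Cauchy-Schwarz turns the quadratic lower bound into one for the norm, after
    cancelling \<open>norm x\<close>.\<close>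
  have lower: "\<gamma> * norm x \<le> norm z" if "T x = Some z" for x z
  proof (cases "x = 0")
    case False
    have "(\<gamma> * norm x) * norm x \<le> norm z * norm x"
      using \<gamma>(2) [OF that] Re_J2_form_le [of z x] by (simp add: power2_eq_square mult.assoc)
    with False show ?thesis by simp
  qed simp
  \<comment> \<open>Chosen so that \<open>\<beta> * (a + 1) * M\<^sup>2 = \<gamma>\<close>: the
    correction then consumes at most the whole positivity of the \<open>J2\<close> form.\<close>
  define \<beta> where "\<beta> = \<gamma> / (M\<^sup>2 * (a + 1))"
  have \<beta>: "\<beta> > 0" using \<gamma> M a by (simp add: \<beta>_def)
  define b where "b x y = s * Re (J2_form x y) - \<beta> * Re (cinner (\<Phi> x) (\<Phi> y))" for x y
  have bb: "bounded_bilinear b"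
    unfolding b_def
    by (intro bounded_bilinear_real_combination bounded_bilinear_Re_J2_form
        bounded_bilinear.comp [OF bounded_bilinear_Re_cinner lin(1) lin(1)])
  have sym: "b x y = b y x" for x y
    unfolding b_def
    using arg_cong [OF J2_form_commute [of x y], of Re] arg_cong [OF cinner_commute [of "\<Phi> x" "\<Phi> y"], of Re]
    by simp
  \<comment> \<open>In \<open>s * b z x\<close> the \<open>J2\<close> term carries
    \<open>s * s = 1\<close>, so only the correction retains a sign, and its modulus is absorbed by
    the \<open>\<gamma>\<close> estimate.\<close>
  have diss: "s * b z x \<ge> 0" if "T x = Some z" for x z
  proof -
    have "\<bar>Re (cinner (\<Phi> z) (\<Phi> x))\<bar> \<le> (a + 1) * (norm (\<Phi> x))\<^sup>2"
      by (rule abs_Re_cinner_riesz_jordan_le [OF T chain \<Phi> onb a(2) nz \<gamma>(1) lower that])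
    also have "\<dots> \<le> (a + 1) * (M\<^sup>2 * (norm x)\<^sup>2)"
      using power_mono [OF M(2) [of x] norm_ge_zero, of 2] a(1)
      by (intro mult_left_mono) (auto simp: power_mult_distrib mult.commute)
    finally have "\<beta> * \<bar>Re (cinner (\<Phi> z) (\<Phi> x))\<bar> \<le> \<beta> * ((a + 1) * (M\<^sup>2 * (norm x)\<^sup>2))"
      using \<beta> by (intro mult_left_mono) auto
    also have "\<dots> = \<gamma> * (norm x)\<^sup>2"
      using a M by (simp add: \<beta>_def)
    also have "\<dots> \<le> Re (J2_form z x)"
      by (rule \<gamma>(2) [OF that])
    finally have "\<beta> * \<bar>Re (cinner (\<Phi> z) (\<Phi> x))\<bar> \<le> Re (J2_form z x)" .
    moreover have "s * (\<beta> * Re (cinner (\<Phi> z) (\<Phi> x))) \<le> \<beta> * \<bar>Re (cinner (\<Phi> z) (\<Phi> x))\<bar>"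
      using abs_ge_self [of "s * (\<beta> * Re (cinner (\<Phi> z) (\<Phi> x)))"] s \<beta> by (simp add: abs_mult)
    moreover have "s * s = 1"
      using s by (metis abs_mult_self_eq mult_1)
    ultimately show ?thesis
      by (simp add: b_def right_diff_distrib mult.assoc [symmetric])
  qed
  \<comment> \<open>Nonnegativity of \<open>b\<close> bounds the \<open>J2\<close> form below by
    \<open>\<beta>\<close> times the squared norm of \<open>\<Phi> x\<close>; since
    \<open>norm x\<close> is at most \<open>K * norm (\<Phi> x)\<close>, this costs the factor
    \<open>1 / K\<^sup>2\<close>.\<close>
  show thesis
  proof (rule that [of "\<beta> / K\<^sup>2"])
    fix x assume "x \<in> root_sum_closure T \<Lambda>"
    then have "b x x \<ge> 0"
      using diss \<Lambda> by (intro form_nonneg_on_root_sum_closure [OF bb sym T]) auto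
    moreover have "(norm x)\<^sup>2 \<le> (norm (\<Phi> x))\<^sup>2 * K\<^sup>2"
      using power_mono [OF K(2) [of "\<Phi> x"] norm_ge_zero, of 2] by (simp add: inv power_mult_distrib)
    then have "\<beta> / K\<^sup>2 * (norm x)\<^sup>2 \<le> \<beta> * (norm (\<Phi> x))\<^sup>2"
      using \<beta> K(1) by (simp add: field_simps)
    ultimately show "\<beta> / K\<^sup>2 * (norm x)\<^sup>2 \<le> s * Re (J2_form x x)"
      by (simp add: b_def cinner_self)
  qed (use \<beta> K in simp)
qed

section \<open>Application to Hamiltonian operator matrices\<close>

lemma Re_J2_form_hamiltonian_nonneg:
  assumes "nonnegative_hamiltonian A B C T" and "T x = Some z"
  shows "Re (J2_form z x) \<ge> 0"
proof (cases x)
  case (Pair u v)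
  from assms have "hamiltonian A B C T" "T (u, v) = Some z"
    by (simp_all add: nonnegative_hamiltonian_def Pair)
  note R = Re_J2_form_hamiltonian [OF this]
  show ?thesis
    unfolding Pair R(3)
    using assms(1) R(1,2)
    by (auto simp: nonnegative_hamiltonian_def nonnegative_op_def less_eq_complex_def)
qed

lemma Re_J2_form_hamiltonian_ge:
  assumes "hamiltonian A B C T" "bounded_below_op \<gamma> B" "bounded_below_op \<gamma> C"
    and "T x = Some z"
  shows "\<gamma> * (norm x)\<^sup>2 \<le> Re (J2_form z x)"
proof (cases x)
  case (Pair u v)
  note R = Re_J2_form_hamiltonian [OF assms(1) assms(4) [unfolded Pair]]
  have "\<gamma> * (norm u)\<^sup>2 \<le> Re (cinner (the (C u)) u)" "\<gamma> * (norm v)\<^sup>2 \<le> Re (cinner (the (B v)) v)"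
    using assms(2,3) R(1,2) by (auto simp: bounded_below_op_def less_eq_complex_def)
  then show ?thesis
    unfolding Pair R(3) by (simp add: norm_prod_def distrib_left)
qed

text \<open>One factor \<open>s\<close> comes from the direction of the orbit and one from the form,
  so dissipativity involves \<open>s * s\<close> and both half-planes reduce to the same inequality
  for \<open>T\<close>.\<close>

lemma sgn_J2_form_on_root_sum_closure:
  fixes T :: "'h::complex_inner \<times> 'h \<rightharpoonup> 'h \<times> 'h"
  assumes T: "nonnegative_hamiltonian A B C T"
    and \<Lambda>: "\<And>\<mu>. \<mu> \<in> \<Lambda> \<Longrightarrow> s * Re \<mu> > 0"
    and x: "x \<in> root_sum_closure T \<Lambda>"
  shows "s * Re (J2_form x x) \<ge> 0"
proof (rule form_nonneg_on_root_sum_closure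
    [where b = "\<lambda>x y. s * Re (J2_form x y)", OF _ _ _ _ \<Lambda> x])
  show "bounded_bilinear (\<lambda>x y :: 'h \<times> 'h. s * Re (J2_form x y))"
    using bounded_bilinear_real_combination
      [OF bounded_bilinear_Re_J2_form bounded_bilinear_Re_J2_form, of s 0] by simp
  show "s * Re (J2_form x y) = s * Re (J2_form y x)" for x y :: "'h \<times> 'h"
    using arg_cong [OF J2_form_commute [of x y], of Re] by simp
  show "linear_op T"
    using T linear_op_hamiltonian by (auto simp: nonnegative_hamiltonian_def)
  show "s * (s * Re (J2_form z x)) \<ge> 0" if "T x = Some z" for x z
    using Re_J2_form_hamiltonian_nonneg [OF T that]
    by (simp add: zero_le_mult_iff mult.assoc [symmetric])
qed

lemma uniform_sgn_J2_form_on_root_sum_closure: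
  fixes T :: "'h::complex_inner \<times> 'h \<rightharpoonup> 'h \<times> 'h"
  assumes "uniformly_positive_hamiltonian A B C T" and basis: "has_riesz_basis_of_jordan_chains T"
    and strip: "\<exists>a\<ge>0. point_spectrum T \<subseteq> {z. \<bar>Re z\<bar> \<le> a}"
    and nz: "0 \<notin> point_spectrum T"
    and s: "\<bar>s\<bar> = 1" "\<And>\<mu>. \<mu> \<in> \<Lambda> \<Longrightarrow> s * Re \<mu> > 0"
  shows "\<exists>\<alpha>>0. \<forall>x\<in>root_sum_closure T \<Lambda>. \<alpha> * (norm x)\<^sup>2 \<le> s * Re (J2_form x x)"
proof -
  from assms(1) obtain \<gamma> where ham: "hamiltonian A B C T"
    and \<gamma>: "\<gamma> > 0" "bounded_below_op \<gamma> B" "bounded_below_op \<gamma> C"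
    unfolding uniformly_positive_hamiltonian_def by blast
  from strip obtain a where a: "a \<ge> 0" "\<And>\<mu>. \<mu> \<in> point_spectrum T \<Longrightarrow> \<bar>Re \<mu>\<bar> \<le> a"
    by blast
  show ?thesis
    by (rule uniform_bound_on_root_sum_closure [OF linear_op_hamiltonian [OF ham] \<gamma>(1)
          Re_J2_form_hamiltonian_ge [OF ham \<gamma>(2,3)] basis a nz s]) blast+
qed

theorem proposition5p6:
  fixes A B C :: "'h::complex_hilbert \<rightharpoonup> 'h"
    and T :: "'h \<times> 'h \<rightharpoonup> 'h \<times> 'h"
    and U_plus U_minus :: "('h \<times> 'h) set"
  assumes "nonnegative_hamiltonian A B C T"
    and "point_spectrum T \<inter> {z. Re z = 0} = {}"
    and "U_plus = root_sum_closure T (point_spectrum_plus T)"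
    and "U_minus = root_sum_closure T (point_spectrum_minus T)"
  shows "J2_nonnegative U_plus \<and> J2_nonpositive U_minus \<and>
    (uniformly_positive_hamiltonian A B C T \<and>
     has_riesz_basis_of_jordan_chains T \<and>
     (\<forall>\<mu>\<in>point_spectrum T. finite_dimensional (root_space T \<mu>)) \<and>
     (\<exists>a\<ge>0. point_spectrum T \<subseteq> {z. \<bar>Re z\<bar> \<le> a})
     \<longrightarrow> uniformly_J2_positive U_plus \<and> uniformly_J2_negative U_minus)"
proof -
  have plus: "1 * Re \<mu> > 0" if "\<mu> \<in> point_spectrum_plus T" for \<mu>
    using that by (simp add: point_spectrum_plus_def)
  have minus: "-1 * Re \<mu> > 0" if "\<mu> \<in> point_spectrum_minus T" for \<mu>
    using that by (simp add: point_spectrum_minus_def)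
  have "J2_nonnegative U_plus"
    unfolding J2_nonnegative_def assms(3)
    using sgn_J2_form_on_root_sum_closure [OF assms(1) plus]
    by (simp add: csubspace_root_sum_closure less_eq_complex_def Im_J2_form_self)
  moreover have "J2_nonpositive U_minus"
    unfolding J2_nonpositive_def assms(4)
    using sgn_J2_form_on_root_sum_closure [OF assms(1) minus]
    by (simp add: csubspace_root_sum_closure less_eq_complex_def Im_J2_form_self)
  moreover have "uniformly_J2_positive U_plus \<and> uniformly_J2_negative U_minus"
    if *: "uniformly_positive_hamiltonian A B C T" "has_riesz_basis_of_jordan_chains T"
      "\<exists>a\<ge>0. point_spectrum T \<subseteq> {z. \<bar>Re z\<bar> \<le> a}"
  proof -
    \<comment> \<open>The point 0 lies on the imaginary axis. Its exclusion is what makes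
      \<open>T\<close> map the span of the chains onto itself.\<close>
    have "0 \<notin> point_spectrum T" using assms(2) by auto
    note bound = uniform_sgn_J2_form_on_root_sum_closure [OF * this]
    show ?thesis
      unfolding uniformly_J2_positive_def uniformly_J2_negative_def assms(3,4)
      using bound [OF _ plus] bound [OF _ minus]
      by (simp add: csubspace_root_sum_closure less_eq_complex_def Im_J2_form_self)
  qed
  ultimately show ?thesis by blast
qed

end
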